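(* For $(M^0,M^1)\in\mathcal M(\theta_0,\theta_1,\theta_\infty)$ let $x_0=m^0_{11}$, $x_1=m^1_{11}$, $x_2=\mathrm{tr}(M^1M^0)$. (1) For $(\hat M^0,\hat M^1)=e^{-\frac{\pi i}2\theta_\infty\sigma_3}S_2^{-1}(M^0,M^1)S_2e^{\frac{\pi i}2\theta_\infty\sigma_3}$ with $\hat M^j=(\hat m^j_{kl})$ ($j=0,1$), write $\hat x_0=\hat m^0_{22}$, $\hat x_1=\hat m^1_{22}$, $\hat x_2=\mathrm{tr}(\hat M^1\hat M^0)$. Then $(\hat x_0,\hat x_1,\hat x_2)\in\mathbf V_{(\theta_0,\theta_1,-\theta_\infty)}$, $(e^{-\pi i\theta_\infty}\hat x_1,e^{-\pi i\theta_\infty}\hat x_0,\hat x_2)\in\mathbf V_{(\theta_0,\theta_1,\theta_\infty)}$, and $$\hat x_0=e^{\pi i\theta_\infty}x_1,\quad\hat x_1=\mathrm{tr}M^1-e^{\pi i\theta_\infty}(x_1x_2+x_0-\mathrm{tr}M^0),\quad\hat x_2=x_2.$$ (2) For $(\check M^0,\check M^1)=e^{\frac{\pi i}2\theta_\infty\sigma_3}S_1(M^0,M^1)S_1^{-1}e^{-\frac{\pi i}2\theta_\infty\sigma_3}$ with $\check M^j=(\check m^j_{kl})$ ($j=0,1$), write $\check x_0=\check m^0_{22}$, $\check x_1=\check m^1_{22}$, $\check x_2=\mathrm{tr}(\check M^1\check M^0)$. Then $(\check x_0,\check x_1,\check x_2)\in\mathbf V_{(\theta_0,\theta_1,-\theta_\infty)}$,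 $(e^{-\pi i\theta_\infty}\check x_1,e^{-\pi i\theta_\infty}\check x_0,\check x_2)\in\mathbf V_{(\theta_0,\theta_1,\theta_\infty)}$, and $$\check x_0=\mathrm{tr}M^0-e^{\pi i\theta_\infty}(x_0x_2+x_1-\mathrm{tr}M^1),\quad\check x_1=e^{\pi i\theta_\infty}x_0,\quad\check x_2=x_2.$$
   Context: $\theta_0,\theta_1,\theta_\infty\in\mathbb{C}$; $\sigma_3=\mathrm{diag}(1,-1)$. $\mathcal M(\theta_0,\theta_1,\theta_\infty)$ is the set of pairs $(M^0,M^1)\in SL_2(\mathbb{C})^2$, $M^0=(m^0_{kl})$, $M^1=(m^1_{kl})$, satisfying $m^0_{11}m^1_{11}+m^0_{21}m^1_{12}=e^{-\pi i\theta_\infty}$, $\mathrm{tr}M^0=2\cos\pi\theta_0$, $\mathrm{tr}M^1=2\cos\pi\theta_1$, modulo $(M^0,M^1)\sim c^{\sigma_3}(M^0,M^1)c^{-\sigma_3}$, $c\in\mathbb{C}\setminus\{0\}$ (here $A(M^0,M^1)A^{-1}$ means $(AM^0A^{-1},AM^1A^{-1})$). The matrices $S_1=\begin{pmatrix}1&0\\ s_1&1\end{pmatrix}$, $S_2=\begin{pmatrix}1&s_2\\ 0&1\end{pmatrix}$ are determined by $M^1M^0=S_1^{-1}e^{-\pi i\theta_\infty\sigma_3}S_2^{-1}$, i.e. $s_2=-e^{\pi i\theta_\infty}(m^0_{12}m^1_{11}+m^0_{22}m^1_{12})$, $s_1=-e^{\pi i\theta_\infty}(m^0_{11}m^1_{21}+m^0_{21}m^1_{22})$.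 The character variety is $$\mathbf V_{(\theta_0,\theta_1,\theta_\infty)}:\ x_0x_1x_2+x_0^2+x_1^2-\mu_0(\theta_\infty)x_0-\mu_1(\theta_\infty)x_1-e^{-\pi i\theta_\infty}x_2+\kappa(\theta_\infty)=0,$$ where, with $T_0=2\cos\pi\theta_0$ $(=\mathrm{tr}M^0)$, $T_1=2\cos\pi\theta_1$ $(=\mathrm{tr}M^1)$, $\mu_0(\theta_\infty)=T_0+e^{-\pi i\theta_\infty}T_1$, $\mu_1(\theta_\infty)=T_1+e^{-\pi i\theta_\infty}T_0$, $\kappa(\theta_\infty)=e^{-2\pi i\theta_\infty}+e^{-\pi i\theta_\infty}T_0T_1+1$; $\mathbf V_{(\theta_0,\theta_1,-\theta_\infty)}$ is obtained by replacing $\theta_\infty$ by $-\theta_\infty$. *)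

theory Defs
  imports "HOL-Analysis.Analysis"
begin

type_synonym cmat = "complex^2^2"

definition mat2 :: "complex \<Rightarrow> complex \<Rightarrow> complex \<Rightarrow> complex \<Rightarrow> cmat" where
  "mat2 a b c d = vector [vector [a, b], vector [c, d]]"

text \<open>\<open>sigma3_pow c\<close> is $c^{\sigma_3} = \mathrm{diag}(c, c^{-1})$; the matrix exponential
  $e^{a\sigma_3}$ is \<open>sigma3_pow (exp a)\<close>.\<close>

definition sigma3_pow :: "complex \<Rightarrow> cmat" where
  "sigma3_pow c = mat2 c 0 0 (inverse c)"

definition SL2 :: "cmat set" where
  "SL2 = {A. det A = 1}"

definition monodromy_pairs :: "complex \<Rightarrow> complex \<Rightarrow> complex \<Rightarrow> (cmat \<times> cmat) set" where
  "monodromy_pairs \<theta>0 \<theta>1 \<theta>inf =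
    {(M0, M1). M0 \<in> SL2 \<and> M1 \<in> SL2 \<and>
       M0$1$1 * M1$1$1 + M0$2$1 * M1$1$2 = exp (- (of_real pi * \<i> * \<theta>inf)) \<and>
       trace M0 = 2 * cos (of_real pi * \<theta>0) \<and> trace M1 = 2 * cos (of_real pi * \<theta>1)}"

definition conj_pair :: "cmat \<Rightarrow> cmat \<times> cmat \<Rightarrow> cmat \<times> cmat" where
  "conj_pair A = (\<lambda>(M0, M1). (A ** M0 ** matrix_inv A, A ** M1 ** matrix_inv A))"

definition monodromy_rel ::
    "complex \<Rightarrow> complex \<Rightarrow> complex \<Rightarrow> ((cmat \<times> cmat) \<times> (cmat \<times> cmat)) set" where
  "monodromy_rel \<theta>0 \<theta>1 \<theta>inf =
    {(P, Q). P \<in> monodromy_pairs \<theta>0 \<theta>1 \<theta>inf \<and> Q \<in> monodromy_pairs \<theta>0 \<theta>1 \<theta>inf \<and>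
       (\<exists>c. c \<noteq> 0 \<and> Q = conj_pair (sigma3_pow c) P)}"

definition monodromy_manifold :: "complex \<Rightarrow> complex \<Rightarrow> complex \<Rightarrow> (cmat \<times> cmat) set set" where
  "monodromy_manifold \<theta>0 \<theta>1 \<theta>inf =
    monodromy_pairs \<theta>0 \<theta>1 \<theta>inf // monodromy_rel \<theta>0 \<theta>1 \<theta>inf"

definition stokes_s1 :: "complex \<Rightarrow> cmat \<Rightarrow> cmat \<Rightarrow> complex" where
  "stokes_s1 \<theta>inf M0 M1 =
    - exp (of_real pi * \<i> * \<theta>inf) * (M0$1$1 * M1$2$1 + M0$2$1 * M1$2$2)"

definition stokes_s2 :: "complex \<Rightarrow> cmat \<Rightarrow> cmat \<Rightarrow> complex" where
  "stokes_s2 \<theta>inf M0 M1 =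
    - exp (of_real pi * \<i> * \<theta>inf) * (M0$1$2 * M1$1$1 + M0$2$2 * M1$1$2)"

definition stokes_S1 :: "complex \<Rightarrow> cmat \<Rightarrow> cmat \<Rightarrow> cmat" where
  "stokes_S1 \<theta>inf M0 M1 = mat2 1 0 (stokes_s1 \<theta>inf M0 M1) 1"

definition stokes_S2 :: "complex \<Rightarrow> cmat \<Rightarrow> cmat \<Rightarrow> cmat" where
  "stokes_S2 \<theta>inf M0 M1 = mat2 1 (stokes_s2 \<theta>inf M0 M1) 0 1"

definition mu0 :: "complex \<Rightarrow> complex \<Rightarrow> complex \<Rightarrow> complex" where
  "mu0 \<theta>0 \<theta>1 \<theta>inf = 2 * cos (of_real pi * \<theta>0) + exp (- (of_real pi * \<i> * \<theta>inf)) * (2 * cos (of_real pi * \<theta>1))"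

definition mu1 :: "complex \<Rightarrow> complex \<Rightarrow> complex \<Rightarrow> complex" where
  "mu1 \<theta>0 \<theta>1 \<theta>inf = 2 * cos (of_real pi * \<theta>1) + exp (- (of_real pi * \<i> * \<theta>inf)) * (2 * cos (of_real pi * \<theta>0))"

definition kappa :: "complex \<Rightarrow> complex \<Rightarrow> complex \<Rightarrow> complex" where
  "kappa \<theta>0 \<theta>1 \<theta>inf = exp (- (2 * of_real pi * \<i> * \<theta>inf))
    + exp (- (of_real pi * \<i> * \<theta>inf)) * (2 * cos (of_real pi * \<theta>0)) * (2 * cos (of_real pi * \<theta>1)) + 1"

definition char_variety :: "complex \<Rightarrow> complex \<Rightarrow> complex \<Rightarrow> (complex \<times> complex \<times> complex) set" where
  "char_variety \<theta>0 \<theta>1 \<theta>inf =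
    {(x0, x1, x2). x0 * x1 * x2 + x0\<^sup>2 + x1\<^sup>2 - mu0 \<theta>0 \<theta>1 \<theta>inf * x0 - mu1 \<theta>0 \<theta>1 \<theta>inf * x1
       - exp (- (of_real pi * \<i> * \<theta>inf)) * x2 + kappa \<theta>0 \<theta>1 \<theta>inf = 0}"

lemma mat2_nth [simp]:
  "mat2 a b c d $ 1 $ 1 = a" "mat2 a b c d $ 1 $ 2 = b"
  "mat2 a b c d $ 2 $ 1 = c" "mat2 a b c d $ 2 $ 2 = d"
  by (simp_all add: mat2_def)

lemma mat2_eq_iff:
  fixes A B :: cmat
  shows "A = B \<longleftrightarrow> A$1$1 = B$1$1 \<and> A$1$2 = B$1$2 \<and> A$2$1 = B$2$1 \<and> A$2$2 = B$2$2"
  by (auto simp: vec_eq_iff forall_2)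

lemma matmul2_nth:
  fixes A B :: cmat
  shows "(A ** B) $ i $ j = A$i$1 * B$1$j + A$i$2 * B$2$j"
  by (simp add: matrix_matrix_mult_def sum_2)

lemma matrix_inv_eqI:
  fixes A B :: cmat
  assumes "A ** B = mat 1"
  shows "matrix_inv A = B"
proof -
  have BA: "B ** A = mat 1" using assms by (simp add: matrix_left_right_inverse)
  have "A ** matrix_inv A = mat 1 \<and> matrix_inv A ** A = mat 1"
    unfolding matrix_inv_def by (rule someI[of _ B]) (simp add: assms BA)
  then show ?thesis
    using BA by (metis matrix_mul_assoc matrix_mul_lid matrix_mul_rid)
qed

lemma matrix_inv_mat2:
  assumes "a * d - b * c = 1"
  shows "matrix_inv (mat2 a b c d) = mat2 d (- b) (- c) a"
  by (rule matrix_inv_eqI) (use assms in \<open>simp add: mat2_eq_iff matmul2_nth mat_def algebra_simps\<close>)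

lemma matrix_inv_sigma3_pow:
  "c \<noteq> 0 \<Longrightarrow> matrix_inv (sigma3_pow c) = sigma3_pow (inverse c)"
  by (simp add: sigma3_pow_def matrix_inv_mat2)

lemma conj_pair_sigma3:
  assumes "c \<noteq> 0"
  shows "conj_pair (sigma3_pow c) (M0, M1) =
    (mat2 (M0$1$1) (c\<^sup>2 * M0$1$2) (M0$2$1 / c\<^sup>2) (M0$2$2),
     mat2 (M1$1$1) (c\<^sup>2 * M1$1$2) (M1$2$1 / c\<^sup>2) (M1$2$2))"
  unfolding conj_pair_def case_prod_conv matrix_inv_sigma3_pow[OF assms]
  using assms
  by (simp add: mat2_eq_iff matmul2_nth sigma3_pow_def
      field_simps power2_eq_square)

lemma equiv_monodromy_rel:
  "equiv (monodromy_pairs \<theta>0 \<theta>1 \<theta>inf) (monodromy_rel \<theta>0 \<theta>1 \<theta>inf)"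
proof (rule equivI)
  show "monodromy_rel \<theta>0 \<theta>1 \<theta>inf \<subseteq> monodromy_pairs \<theta>0 \<theta>1 \<theta>inf \<times> monodromy_pairs \<theta>0 \<theta>1 \<theta>inf"
    by (auto simp: monodromy_rel_def)
  have one: "P = conj_pair (sigma3_pow 1) P" for P
    by (cases P) (simp add: conj_pair_sigma3 mat2_eq_iff)
  show "refl_on (monodromy_pairs \<theta>0 \<theta>1 \<theta>inf) (monodromy_rel \<theta>0 \<theta>1 \<theta>inf)"
  proof (rule refl_onI)
    fix P assume "P \<in> monodromy_pairs \<theta>0 \<theta>1 \<theta>inf"
    moreover have "\<exists>c. c \<noteq> 0 \<and> P = conj_pair (sigma3_pow c) P"
      by (rule exI[of _ 1]) (rule conjI[OF one_neq_zero one])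
    ultimately show "(P, P) \<in> monodromy_rel \<theta>0 \<theta>1 \<theta>inf"
      by (simp only: monodromy_rel_def mem_Collect_eq case_prod_conv simp_thms)
  qed
  have inv: "conj_pair (sigma3_pow (inverse c)) (conj_pair (sigma3_pow c) P) = P" if "c \<noteq> 0" for c P
    using that by (cases P) (simp add: conj_pair_sigma3 mat2_eq_iff field_simps)
  show "sym (monodromy_rel \<theta>0 \<theta>1 \<theta>inf)"
  proof (rule symI)
    fix P Q assume "(P, Q) \<in> monodromy_rel \<theta>0 \<theta>1 \<theta>inf"
    then obtain c where PQ: "P \<in> monodromy_pairs \<theta>0 \<theta>1 \<theta>inf" "Q \<in> monodromy_pairs \<theta>0 \<theta>1 \<theta>inf"
      and c: "c \<noteq> 0" "Q = conj_pair (sigma3_pow c) P"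
      unfolding monodromy_rel_def by blast
    have "inverse c \<noteq> 0" "P = conj_pair (sigma3_pow (inverse c)) Q"
      using c inv[of c P] by simp_all
    then show "(Q, P) \<in> monodromy_rel \<theta>0 \<theta>1 \<theta>inf"
      unfolding monodromy_rel_def using PQ by blast
  qed
  have mult: "conj_pair (sigma3_pow d) (conj_pair (sigma3_pow c) P) = conj_pair (sigma3_pow (d * c)) P"
    if "c \<noteq> 0" "d \<noteq> 0" for c d P
    using that by (cases P) (simp add: conj_pair_sigma3 mat2_eq_iff field_simps)
  show "trans (monodromy_rel \<theta>0 \<theta>1 \<theta>inf)"
  proof (rule transI)
    fix P Q R
    assume "(P, Q) \<in> monodromy_rel \<theta>0 \<theta>1 \<theta>inf" "(Q, R) \<in> monodromy_rel \<theta>0 \<theta>1 \<theta>inf"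
    then obtain c d where PR: "P \<in> monodromy_pairs \<theta>0 \<theta>1 \<theta>inf" "R \<in> monodromy_pairs \<theta>0 \<theta>1 \<theta>inf"
      and cd: "c \<noteq> 0" "d \<noteq> 0" "Q = conj_pair (sigma3_pow c) P" "R = conj_pair (sigma3_pow d) Q"
      unfolding monodromy_rel_def by blast
    have "d * c \<noteq> 0" "R = conj_pair (sigma3_pow (d * c)) P"
      using cd mult[of c d P] by simp_all
    then show "(P, R) \<in> monodromy_rel \<theta>0 \<theta>1 \<theta>inf"
      unfolding monodromy_rel_def using PR by blast
  qed
qed

lemma coordinates_invariant:
  assumes "((M0, M1), (N0, N1)) \<in> monodromy_rel \<theta>0 \<theta>1 \<theta>inf"
  shows "N0$1$1 = M0$1$1" "N1$1$1 = M1$1$1" "trace (N1 ** N0) = trace (M1 ** M0)"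
  using assms
  by (auto simp: monodromy_rel_def conj_pair_sigma3 trace_def sum_2 matmul2_nth)

text \<open>\<open>stokes_s1\<close> and \<open>stokes_s2\<close> are exactly the entries determined by
  $M^1 M^0 = S_1^{-1} e^{-\pi i \theta_\infty \sigma_3} S_2^{-1}$.\<close>

lemma stokes_factorization_iff:
  assumes "(M0, M1) \<in> monodromy_pairs \<theta>0 \<theta>1 \<theta>inf"
  shows "M1 ** M0 = matrix_inv (mat2 1 0 s1 1) ** sigma3_pow (exp (- (of_real pi * \<i> * \<theta>inf)))
            ** matrix_inv (mat2 1 s2 0 1)
    \<longleftrightarrow> s1 = stokes_s1 \<theta>inf M0 M1 \<and> s2 = stokes_s2 \<theta>inf M0 M1"
proof -
  define e where "e = exp (- (of_real pi * \<i> * \<theta>inf))"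
  define f where "f = exp (of_real pi * \<i> * \<theta>inf)"
  have ef: "e * f = 1" "inverse e = f" by (simp_all add: e_def f_def exp_minus)
  have c: "M0$1$1 * M1$1$1 + M0$2$1 * M1$1$2 = e"
    and d: "M0$1$1 * M0$2$2 - M0$1$2 * M0$2$1 = 1" "M1$1$1 * M1$2$2 - M1$1$2 * M1$2$1 = 1"
    using assms by (auto simp: monodromy_pairs_def SL2_def det_2 e_def)
  define p where "p = M0$1$2 * M1$1$1 + M0$2$2 * M1$1$2"
  define q where "q = M0$1$1 * M1$2$1 + M0$2$1 * M1$2$2"
  define r where "r = M0$1$2 * M1$2$1 + M0$2$2 * M1$2$2"
  have "e * r - p * q =
      (M0$1$1 * M0$2$2 - M0$1$2 * M0$2$1) * (M1$1$1 * M1$2$2 - M1$1$2 * M1$2$1)"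
    unfolding p_def q_def r_def c[symmetric] by (simp add: algebra_simps)
  then have det: "e * r = p * q + 1"
    by (simp add: d algebra_simps)
  have l: "M1 ** M0 = mat2 e p q r"
    using c by (simp add: mat2_eq_iff matmul2_nth p_def q_def r_def algebra_simps)
  have m: "matrix_inv (mat2 1 0 s1 1) ** sigma3_pow e ** matrix_inv (mat2 1 s2 0 1)
      = mat2 e (- (e * s2)) (- (e * s1)) (e * s1 * s2 + f)"
    by (simp add: matrix_inv_mat2 mat2_eq_iff matmul2_nth sigma3_pow_def ef)
  have iff: "p = - (e * s2) \<and> q = - (e * s1) \<and> r = e * s1 * s2 + f
      \<longleftrightarrow> s1 = - f * q \<and> s2 = - f * p"
    (is "?L \<longleftrightarrow> ?R")
  proof
    assume L: ?L
    then have "- f * p = (e * f) * s2" "- f * q = (e * f) * s1" by simp_all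
    then show ?R using ef(1) by simp
  next
    assume R: ?R
    have "e * s2 = - ((e * f) * p)" "e * s1 = - ((e * f) * q)" using R by simp_all
    moreover have "e * s1 * s2 + f = f * ((e * f) * (p * q) + 1)"
      using R by (simp add: algebra_simps)
    moreover have "f * (p * q + 1) = (e * f) * r"
      unfolding det[symmetric] by (simp add: ac_simps)
    ultimately show ?L using ef(1) by simp
  qed
  show ?thesis
    unfolding e_def[symmetric] f_def[symmetric] l m stokes_s1_def stokes_s2_def
      p_def[symmetric] q_def[symmetric] using iff by (simp add: mat2_eq_iff)
qed

text \<open>Another representative of the same class changes $S_1$ and $S_2$ by conjugation with
  $c^{\sigma_3}$, so a pair obtained from $(M^0, M^1)$ by conjugating with $S_2^{-1}$ or $S_1$ also
  changes only by conjugation with $c^{\sigma_3}$.\<close>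

lemma stokes_conj:
  assumes "c \<noteq> 0" "conj_pair (sigma3_pow c) (M0, M1) = (N0, N1)"
  shows "stokes_S1 \<theta>inf N0 N1 = sigma3_pow c ** stokes_S1 \<theta>inf M0 M1 ** matrix_inv (sigma3_pow c)"
    "stokes_S2 \<theta>inf N0 N1 = sigma3_pow c ** stokes_S2 \<theta>inf M0 M1 ** matrix_inv (sigma3_pow c)"
proof -
  have N: "N0 = mat2 (M0$1$1) (c\<^sup>2 * M0$1$2) (M0$2$1 / c\<^sup>2) (M0$2$2)"
    "N1 = mat2 (M1$1$1) (c\<^sup>2 * M1$1$2) (M1$2$1 / c\<^sup>2) (M1$2$2)"
    using assms by (simp_all add: conj_pair_sigma3)
  show "stokes_S1 \<theta>inf N0 N1 = sigma3_pow c ** stokes_S1 \<theta>inf M0 M1 ** matrix_inv (sigma3_pow c)"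
    "stokes_S2 \<theta>inf N0 N1 = sigma3_pow c ** stokes_S2 \<theta>inf M0 M1 ** matrix_inv (sigma3_pow c)"
    unfolding matrix_inv_sigma3_pow[OF assms(1)]
    using assms(1)
    by (simp_all add: N stokes_S1_def stokes_S2_def stokes_s1_def stokes_s2_def mat2_eq_iff
        matmul2_nth sigma3_pow_def divide_simps power2_eq_square, simp_all add: algebra_simps)
qed

end

theory Submission
  imports Defs
begin

text \<open>
  Put $e = e^{-\pi i\theta_\infty}$. The character variety is the zero set of a cubic
  $F_e(x_0,x_1,x_2)$ with two kinds of symmetry. The first is a scaling:
  $e^2 F_{1/e}(y_0,y_1,y_2) = F_e(e y_1, e y_0, y_2)$, so
  $(y_0,y_1,y_2)$ lies on the variety for $-\theta_\infty$ if and only if $(e y_1, e y_0, y_2)$ lies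
  on the variety for $\theta_\infty$ (\<open>char_variety_uminus_iff\<close>). The second comes from the fact
  that $F_e$ is a monic quadratic in $x_0$ and in $x_1$ separately; by Vieta's formulas the other
  root of each quadratic gives again a point of the variety
  (\<open>char_variety_vieta0\<close>, \<open>char_variety_vieta1\<close>).

  The coordinates of a pair of monodromy matrices lie on the variety
  (\<open>monodromy_coordinates_in_char_variety\<close>): substituting
  $e = m^0_{11}m^1_{11}+m^0_{21}m^1_{12}$ and the traces turns the cubic into
  $(m^0_{11}m^0_{22}-1)(m^1_{11}m^1_{22}-1) - m^0_{12}m^0_{21}m^1_{12}m^1_{21}$,
  which vanishes because both determinants are $1$. Conjugation by $S_2^{-1}$ adds a multiple of the
  lower left entry to the lower right one, conjugation by $S_1$ a multiple of the upper right entry,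
  and the diagonal factors change neither diagonal entries nor traces. With the
  relations between the entries this yields the explicit formulas, and they say that after the scaling the new point is the
  Vieta transform of the old one in $x_0$ (for $S_2$) or in $x_1$ (for $S_1$).
\<close>

lemma char_variety_uminus_iff:
  "(y0, y1, y2) \<in> char_variety \<theta>0 \<theta>1 (- \<theta>inf) \<longleftrightarrow>
   (exp (- (of_real pi * \<i> * \<theta>inf)) * y1, exp (- (of_real pi * \<i> * \<theta>inf)) * y0, y2)
     \<in> char_variety \<theta>0 \<theta>1 \<theta>inf"
proof -
  define e where "e = exp (- (of_real pi * \<i> * \<theta>inf))"
  define f where "f = exp (of_real pi * \<i> * \<theta>inf)"
  define T0 where "T0 = 2 * cos (of_real pi * \<theta>0)"
  define T1 where "T1 = 2 * cos (of_real pi * \<theta>1)"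
  have ef: "e * f = 1" and e0: "e \<noteq> 0" by (simp_all add: e_def f_def exp_minus)
  have e2: "exp (- (2 * of_real pi * \<i> * \<theta>inf)) = e\<^sup>2"
    and f2: "exp (2 * of_real pi * \<i> * \<theta>inf) = f\<^sup>2"
    by (simp_all add: e_def f_def flip: exp_double) (simp_all add: mult.assoc)
  define G where "G = y0 * y1 * y2 + y0\<^sup>2 + y1\<^sup>2 - (T0 + f * T1) * y0 - (T1 + f * T0) * y1
    - f * y2 + (f\<^sup>2 + f * T0 * T1 + 1)"
  define H where "H = (e * y1) * (e * y0) * y2 + (e * y1)\<^sup>2 + (e * y0)\<^sup>2 - (T0 + e * T1) * (e * y1)
    - (T1 + e * T0) * (e * y0) - e * y2 + (e\<^sup>2 + e * T0 * T1 + 1)"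
  have "e\<^sup>2 * G = H"
    unfolding G_def H_def using ef by algebra
  then have "G = 0 \<longleftrightarrow> H = 0" using e0 by auto
  moreover have "(y0, y1, y2) \<in> char_variety \<theta>0 \<theta>1 (- \<theta>inf) \<longleftrightarrow> G = 0"
    by (simp add: char_variety_def mu0_def mu1_def kappa_def G_def f2
        flip: f_def T0_def T1_def)
  moreover have "(e * y1, e * y0, y2) \<in> char_variety \<theta>0 \<theta>1 \<theta>inf \<longleftrightarrow> H = 0"
    by (simp add: char_variety_def mu0_def mu1_def kappa_def H_def e2
        flip: e_def T0_def T1_def)
  ultimately show ?thesis by (simp flip: e_def)
qed

text \<open>The two roots in $x_0$ sum to $\mu_0 - x_1x_2$, those in $x_1$ to $\mu_1 - x_0x_2$.\<close>

lemma char_variety_vieta0: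
  assumes "(x0, x1, x2) \<in> char_variety \<theta>0 \<theta>1 \<theta>inf"
  shows "(mu0 \<theta>0 \<theta>1 \<theta>inf - x1 * x2 - x0, x1, x2) \<in> char_variety \<theta>0 \<theta>1 \<theta>inf"
  using assms unfolding char_variety_def mem_Collect_eq case_prod_conv by algebra

lemma char_variety_vieta1:
  assumes "(x0, x1, x2) \<in> char_variety \<theta>0 \<theta>1 \<theta>inf"
  shows "(x0, mu1 \<theta>0 \<theta>1 \<theta>inf - x0 * x2 - x1, x2) \<in> char_variety \<theta>0 \<theta>1 \<theta>inf"
  using assms unfolding char_variety_def mem_Collect_eq case_prod_conv by algebra

lemma monodromy_coordinates_in_char_variety:
  assumes "(M0, M1) \<in> monodromy_pairs \<theta>0 \<theta>1 \<theta>inf"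
  shows "(M0$1$1, M1$1$1, trace (M1 ** M0)) \<in> char_variety \<theta>0 \<theta>1 \<theta>inf"
proof -
  define e where "e = exp (- (of_real pi * \<i> * \<theta>inf))"
  define T0 where "T0 = 2 * cos (of_real pi * \<theta>0)"
  define T1 where "T1 = 2 * cos (of_real pi * \<theta>1)"
  have e2: "exp (- (2 * of_real pi * \<i> * \<theta>inf)) = e\<^sup>2"
    by (simp add: e_def flip: exp_double) (simp add: mult.assoc)
  have e: "M0$1$1 * M1$1$1 + M0$2$1 * M1$1$2 = e"
    and d: "M0$1$1 * M0$2$2 - M0$1$2 * M0$2$1 = 1" "M1$1$1 * M1$2$2 - M1$1$2 * M1$2$1 = 1"
    and T: "M0$1$1 + M0$2$2 = T0" "M1$1$1 + M1$2$2 = T1"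
    using assms
    by (auto simp: monodromy_pairs_def SL2_def det_2 trace_def sum_2 e_def T0_def T1_def)
  define x2 where "x2 = trace (M1 ** M0)"
  have x2: "x2 = M1$1$1 * M0$1$1 + M1$1$2 * M0$2$1 + (M1$2$1 * M0$1$2 + M1$2$2 * M0$2$2)"
    by (simp add: x2_def trace_def sum_2 matmul2_nth)
  have "M0$1$1 * M1$1$1 * x2 + (M0$1$1)\<^sup>2 + (M1$1$1)\<^sup>2 - (T0 + e * T1) * M0$1$1
      - (T1 + e * T0) * M1$1$1 - e * x2 + (e\<^sup>2 + e * T0 * T1 + 1)
      = (M0$1$1 * M0$2$2 - 1) * (M1$1$1 * M1$2$2 - 1) - M0$1$2 * M0$2$1 * (M1$1$2 * M1$2$1)"
    unfolding x2 e[symmetric] T[symmetric] by (simp add: power2_eq_square algebra_simps)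
  also have "M0$1$1 * M0$2$2 - 1 = M0$1$2 * M0$2$1" using d(1) by (simp add: algebra_simps)
  also have "M1$1$1 * M1$2$2 - 1 = M1$1$2 * M1$2$1" using d(2) by (simp add: algebra_simps)
  finally have "M0$1$1 * M1$1$1 * x2 + (M0$1$1)\<^sup>2 + (M1$1$1)\<^sup>2 - (T0 + e * T1) * M0$1$1
      - (T1 + e * T0) * M1$1$1 - e * x2 + (e\<^sup>2 + e * T0 * T1 + 1) = 0"
    by simp
  then show ?thesis
    by (simp add: char_variety_def mu0_def mu1_def kappa_def e2 flip: e_def T0_def T1_def x2_def)
qed

lemma trace_conj:
  fixes A B M N :: cmat
  assumes "A ** B = mat 1"
  shows "trace ((B ** N ** A) ** (B ** M ** A)) = trace (N ** M)"
proof -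
  have "(B ** N ** A) ** (B ** M ** A) = B ** N ** (A ** B) ** M ** A"
    by (simp add: matrix_mul_assoc)
  also have "\<dots> = B ** (N ** M ** A)"
    by (simp add: assms matrix_mul_assoc)
  also have "trace \<dots> = trace (N ** M ** A ** B)"
    by (rule trace_mul_sym)
  also have "N ** M ** A ** B = N ** M ** (A ** B)"
    by (simp add: matrix_mul_assoc)
  finally show ?thesis by (simp add: assms)
qed

lemma upper_conj_entry22:
  assumes "c \<noteq> 0"
  shows "(sigma3_pow (inverse c) ** matrix_inv (mat2 1 s 0 1) ** M ** mat2 1 s 0 1
    ** sigma3_pow c) $ 2 $ 2 = M$2$2 + s * M$2$1"
  using assms by (simp add: matrix_inv_mat2 matmul2_nth sigma3_pow_def field_simps)

lemma lower_conj_entry22: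
  assumes "c \<noteq> 0"
  shows "(sigma3_pow c ** mat2 1 0 s 1 ** M ** matrix_inv (mat2 1 0 s 1)
    ** sigma3_pow (inverse c)) $ 2 $ 2 = M$2$2 + s * M$1$2"
  using assms by (simp add: matrix_inv_mat2 matmul2_nth sigma3_pow_def field_simps)

lemma upper_conj_trace:
  assumes "c \<noteq> 0"
  shows "trace ((sigma3_pow (inverse c) ** matrix_inv (mat2 1 s 0 1) ** N ** mat2 1 s 0 1
      ** sigma3_pow c) ** (sigma3_pow (inverse c) ** matrix_inv (mat2 1 s 0 1) ** M
      ** mat2 1 s 0 1 ** sigma3_pow c)) = trace (N ** M)"
proof -
  have "(mat2 1 s 0 1 ** sigma3_pow c)
      ** (sigma3_pow (inverse c) ** matrix_inv (mat2 1 s 0 1)) = mat 1"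
    using assms
    by (simp add: matrix_inv_mat2 mat2_eq_iff matmul2_nth sigma3_pow_def mat_def)
  from trace_conj[OF this, of N M] show ?thesis
    by (simp add: matrix_mul_assoc)
qed

lemma lower_conj_trace:
  assumes "c \<noteq> 0"
  shows "trace ((sigma3_pow c ** mat2 1 0 s 1 ** N ** matrix_inv (mat2 1 0 s 1)
      ** sigma3_pow (inverse c)) ** (sigma3_pow c ** mat2 1 0 s 1 ** M
      ** matrix_inv (mat2 1 0 s 1) ** sigma3_pow (inverse c))) = trace (N ** M)"
proof -
  have "(matrix_inv (mat2 1 0 s 1) ** sigma3_pow (inverse c))
      ** (sigma3_pow c ** mat2 1 0 s 1) = mat 1"
    using assms
    by (simp add: matrix_inv_mat2 mat2_eq_iff matmul2_nth sigma3_pow_def mat_def)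
  from trace_conj[OF this, of N M] show ?thesis
    by (simp add: matrix_mul_assoc)
qed

theorem theorem2p18:
  fixes \<theta>0 \<theta>1 \<theta>inf :: complex
    and X :: "(cmat \<times> cmat) set"
    and M0 M1 hM0 hM1 kM0 kM1 S1 S2 :: cmat
    and x0 x1 x2 hx0 hx1 hx2 kx0 kx1 kx2 :: complex
  assumes "X \<in> monodromy_manifold \<theta>0 \<theta>1 \<theta>inf" and "(M0, M1) \<in> X"
    and "S1 = stokes_S1 \<theta>inf M0 M1" and "S2 = stokes_S2 \<theta>inf M0 M1"
    and "x0 = M0$1$1" and "x1 = M1$1$1" and "x2 = trace (M1 ** M0)"
    and "hM0 = sigma3_pow (exp (- (of_real pi * \<i> / 2 * \<theta>inf))) ** matrix_inv S2 ** M0 ** S2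
           ** sigma3_pow (exp (of_real pi * \<i> / 2 * \<theta>inf))"
    and "hM1 = sigma3_pow (exp (- (of_real pi * \<i> / 2 * \<theta>inf))) ** matrix_inv S2 ** M1 ** S2
           ** sigma3_pow (exp (of_real pi * \<i> / 2 * \<theta>inf))"
    and "hx0 = hM0$2$2" and "hx1 = hM1$2$2" and "hx2 = trace (hM1 ** hM0)"
    and "kM0 = sigma3_pow (exp (of_real pi * \<i> / 2 * \<theta>inf)) ** S1 ** M0 ** matrix_inv S1
           ** sigma3_pow (exp (- (of_real pi * \<i> / 2 * \<theta>inf)))"
    and "kM1 = sigma3_pow (exp (of_real pi * \<i> / 2 * \<theta>inf)) ** S1 ** M1 ** matrix_inv S1
           ** sigma3_pow (exp (- (of_real pi * \<i> / 2 * \<theta>inf)))"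
    and "kx0 = kM0$2$2" and "kx1 = kM1$2$2" and "kx2 = trace (kM1 ** kM0)"
  shows
    "((hx0, hx1, hx2) \<in> char_variety \<theta>0 \<theta>1 (- \<theta>inf) \<and>
      (exp (- (of_real pi * \<i> * \<theta>inf)) * hx1, exp (- (of_real pi * \<i> * \<theta>inf)) * hx0, hx2)
        \<in> char_variety \<theta>0 \<theta>1 \<theta>inf \<and>
      hx0 = exp (of_real pi * \<i> * \<theta>inf) * x1 \<and>
      hx1 = trace M1 - exp (of_real pi * \<i> * \<theta>inf) * (x1 * x2 + x0 - trace M0) \<and>
      hx2 = x2) \<and>
     ((kx0, kx1, kx2) \<in> char_variety \<theta>0 \<theta>1 (- \<theta>inf) \<and>
      (exp (- (of_real pi * \<i> * \<theta>inf)) * kx1, exp (- (of_real pi * \<i> * \<theta>inf)) * kx0, kx2)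
        \<in> char_variety \<theta>0 \<theta>1 \<theta>inf \<and>
      kx0 = trace M0 - exp (of_real pi * \<i> * \<theta>inf) * (x0 * x2 + x1 - trace M1) \<and>
      kx1 = exp (of_real pi * \<i> * \<theta>inf) * x0 \<and>
      kx2 = x2)"
proof -
  define e where "e = exp (- (of_real pi * \<i> * \<theta>inf))"
  define f where "f = exp (of_real pi * \<i> * \<theta>inf)"
  define c where "c = exp (of_real pi * \<i> / 2 * \<theta>inf)"
  have ef: "e * f = 1" by (simp add: e_def f_def exp_minus)
  have c: "c \<noteq> 0" "exp (- (of_real pi * \<i> / 2 * \<theta>inf)) = inverse c"
    by (simp_all add: c_def exp_minus)
  have P: "(M0, M1) \<in> monodromy_pairs \<theta>0 \<theta>1 \<theta>inf"
    using assms(1,2) in_quotient_imp_subset[OF equiv_monodromy_rel]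
    unfolding monodromy_manifold_def by blast
  then have e: "M0$1$1 * M1$1$1 + M0$2$1 * M1$1$2 = e"
    and d: "M0$1$1 * M0$2$2 - M0$1$2 * M0$2$1 = 1" "M1$1$1 * M1$2$2 - M1$1$2 * M1$2$1 = 1"
    and tr: "2 * cos (of_real pi * \<theta>0) = trace M0" "2 * cos (of_real pi * \<theta>1) = trace M1"
    by (auto simp: monodromy_pairs_def SL2_def det_2 e_def)
  have V: "(x0, x1, x2) \<in> char_variety \<theta>0 \<theta>1 \<theta>inf"
    using monodromy_coordinates_in_char_variety[OF P] assms(5-7) by simp
  have T: "trace M0 = M0$1$1 + M0$2$2" "trace M1 = M1$1$1 + M1$2$2"
    by (simp_all add: trace_def sum_2)
  have x2: "x2 = M1$1$1 * M0$1$1 + M1$1$2 * M0$2$1 + (M1$2$1 * M0$1$2 + M1$2$2 * M0$2$2)"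
    by (simp add: assms(7) trace_def sum_2 matmul2_nth)
  define s1 where "s1 = stokes_s1 \<theta>inf M0 M1"
  define s2 where "s2 = stokes_s2 \<theta>inf M0 M1"
  have S: "S1 = mat2 1 0 s1 1" "S2 = mat2 1 s2 0 1"
    by (simp_all add: assms(3,4) stokes_S1_def stokes_S2_def s1_def s2_def)
  have s1: "s1 = - f * (M0$1$1 * M1$2$1 + M0$2$1 * M1$2$2)"
    by (simp add: s1_def stokes_s1_def f_def)
  have s2: "s2 = - f * (M0$1$2 * M1$1$1 + M0$2$2 * M1$1$2)"
    by (simp add: s2_def stokes_s2_def f_def)

  note hM = assms(8,9)[unfolded c(2) S, folded c_def]
  have h: "hx0 = M0$2$2 + s2 * M0$2$1" "hx1 = M1$2$2 + s2 * M1$2$1"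
    unfolding assms(10,11) hM by (rule upper_conj_entry22[OF c(1)])+
  have hx2: "hx2 = x2"
    unfolding assms(7,12) hM by (rule upper_conj_trace[OF c(1)])
  have hx0: "hx0 = f * x1"
    using h(1) s2 e d ef assms(6) by algebra
  have hx1: "hx1 = trace M1 - f * (x1 * x2 + x0 - trace M0)"
    unfolding T using h(2) s2 e d ef x2 assms(5,6) by algebra
  \<comment> \<open>up to scaling, the new point has the same $x_1$ and the other root in $x_0$\<close>
  have "e * hx1 = mu0 \<theta>0 \<theta>1 \<theta>inf - x1 * x2 - x0" "e * hx0 = x1"
    unfolding mu0_def tr e_def[symmetric] using hx0 hx1 ef by algebra+
  then have hV: "(e * hx1, e * hx0, hx2) \<in> char_variety \<theta>0 \<theta>1 \<theta>inf"
    using char_variety_vieta0[OF V] hx2 by simp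

  note kM = assms(13,14)[unfolded c(2) S, folded c_def]
  have k: "kx0 = M0$2$2 + s1 * M0$1$2" "kx1 = M1$2$2 + s1 * M1$1$2"
    unfolding assms(15,16) kM by (rule lower_conj_entry22[OF c(1)])+
  have kx2: "kx2 = x2"
    unfolding assms(7,17) kM by (rule lower_conj_trace[OF c(1)])
  have kx1: "kx1 = f * x0"
    using k(2) s1 e d ef assms(5) by algebra
  have kx0: "kx0 = trace M0 - f * (x0 * x2 + x1 - trace M1)"
    unfolding T using k(1) s1 e d ef x2 assms(5,6) by algebra
  \<comment> \<open>here $x_0$ is kept and $x_1$ is replaced by the other root\<close>
  have "e * kx1 = x0" "e * kx0 = mu1 \<theta>0 \<theta>1 \<theta>inf - x0 * x2 - x1"
    unfolding mu1_def tr e_def[symmetric] using kx0 kx1 ef by algebra+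
  then have kV: "(e * kx1, e * kx0, kx2) \<in> char_variety \<theta>0 \<theta>1 \<theta>inf"
    using char_variety_vieta1[OF V] kx2 by simp

  show ?thesis
    unfolding char_variety_uminus_iff[of _ _ _ \<theta>0 \<theta>1 \<theta>inf] e_def[symmetric] f_def[symmetric]
    using hV hx0 hx1 hx2 kV kx0 kx1 kx2 by blast
qed

end
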